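(* Let $n\ge 1$ and $0\le m\le\binom n2$ be integers. The vertices of the polytope $D^{n,m}_2$ are precisely the degree sequences of threshold graphs on $[n]$ with $m$ edges. So for any convex function $f:\{0,1,\dots,m\}^n\rightarrow\mathbb{R}$ there is a threshold graph $G$ on $[n]$ with $m$ edges whose degree sequence $\sum G$ maximizes $f$ over the degree sequences of all graphs on $[n]$ with $m$ edges.
   Context: Let $[n]:=\{1,\dots,n\}$ and $\{0,1\}^n_2:=\{x\in\{0,1\}^n:\|x\|_1=2\}$. A (simple) graph on $[n]$ is identified with a subset $G\subseteq\{0,1\}^n_2$ (the indicator vectors of its edges); its degree sequence is $\sum G:=\sum\{x:x\in G\}$. The degree sequence polytope with prescribed number $m$ of edges is the convex hull $D^{n,m}_2:=\mathrm{conv}\{\sum G:G\subseteq\{0,1\}^n_2,\ |G|=m\}\subset\mathbb{R}^n$. A graph $G$ on $[n]$ is a threshold graph if for some permutation $\pi$ of $[n]$, each vertex $\pi(i)$ is connected to either all or none of the vertices $\pi(j)$, $j<i$. A function $f:\{0,1,\dots,m\}^n\rightarrow\mathbb{R}$ is convex if it is the restriction of a convex function on $\mathbb{R}^n$. *)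

theory Defs
  imports "HOL-Analysis.Analysis"
begin

text \<open>
  The vertex set $[n]$ is rendered by an arbitrary finite type \<open>'n\<close> with
  \<open>CARD('n)\<close> elements, so that $R^n$ is \<open>real ^ 'n\<close>; an edge is its
  0/1 indicator vector and a simple graph is a set of such vectors.
\<close>

definition edge_vectors :: "(real ^ 'n::finite) set" where
  "edge_vectors = {x. (\<forall>i. x $ i \<in> {0, 1}) \<and> (\<Sum>i\<in>UNIV. \<bar>x $ i\<bar>) = 2}"

definition degree_seq :: "(real ^ 'n::finite) set \<Rightarrow> real ^ 'n" where
  "degree_seq G = (\<Sum>x\<in>G. x)"

definition graphs_with_edges :: "nat \<Rightarrow> (real ^ 'n::finite) set set" where
  "graphs_with_edges m = {G. G \<subseteq> edge_vectors \<and> card G = m}"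

definition degree_seq_polytope :: "nat \<Rightarrow> (real ^ 'n::finite) set" where
  "degree_seq_polytope m = convex hull {degree_seq G | G. G \<in> graphs_with_edges m}"

definition adjacent :: "(real ^ 'n::finite) set \<Rightarrow> 'n \<Rightarrow> 'n \<Rightarrow> bool" where
  "adjacent G u v \<longleftrightarrow> axis u 1 + axis v 1 \<in> G"

text \<open>
  As the vertex type carries no order, a permutation of $[n]$ becomes a
  bijection from \<open>{1..CARD('n)}\<close> onto the vertices.
\<close>

definition threshold_graph :: "(real ^ 'n::finite) set \<Rightarrow> bool" where
  "threshold_graph G \<longleftrightarrow> G \<subseteq> edge_vectors \<and>
     (\<exists>\<pi> :: nat \<Rightarrow> 'n. bij_betw \<pi> {1..CARD('n)} UNIV \<and>
       (\<forall>i\<in>{1..CARD('n)}.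
          (\<forall>j\<in>{1..<i}. adjacent G (\<pi> i) (\<pi> j)) \<or>
          (\<forall>j\<in>{1..<i}. \<not> adjacent G (\<pi> i) (\<pi> j))))"

definition grid :: "nat \<Rightarrow> (real ^ 'n::finite) set" where
  "grid m = {x. \<forall>i. x $ i \<in> of_nat ` {0..m}}"

text \<open>
  A function on the grid $\{0,\dots,m\}^n$ is represented by a total function
  on \<open>real ^ 'n\<close> whose values outside the grid are irrelevant.
\<close>

definition convex_on_grid :: "nat \<Rightarrow> (real ^ 'n::finite \<Rightarrow> real) \<Rightarrow> bool" where
  "convex_on_grid m f \<longleftrightarrow> (\<exists>g. convex_on UNIV g \<and> (\<forall>x\<in>grid m. f x = g x))"

end

theory Submission
  imports Defs
begin

text \<open>
  Linear functionals carry both directions. For \<open>c :: real ^ 'n\<close> put the weight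
  \<open>c $ u + c $ v\<close> on the edge \<open>uv\<close>; then \<open>c \<bullet> degree_seq G\<close> is the total weight of \<open>G\<close>.

  A threshold graph comes with an order of the vertices in which each vertex is joined to all
  or to none of its predecessors. Giving the \<open>i\<close>-th vertex the weight \<open>i\<close> in the first case and
  \<open>- i\<close> in the second makes every edge weight positive and every non-edge weight negative,
  because the later endpoint decides the sign. So the graph is the only one of maximal weight
  among the graphs with its number of edges, and its degree sequence is a vertex of the polytope.

  Conversely, a vertex of a polytope is exposed, so it is the only maximiser of some \<open>c\<close>.
  If \<open>G\<close> realises that vertex, \<open>c $ v \<le> c $ u\<close> and \<open>v\<close> is joined to \<open>x \<noteq> u\<close>, then \<open>u\<close> must be
  joined to \<open>x\<close> too: otherwise moving the edge \<open>vx\<close> to \<open>ux\<close> changes the degree sequence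
  without lowering its \<open>c\<close>-value. This domination property is inherited by subsets of the
  vertices, and in each nonempty subset it produces a vertex joined to all or to none of the
  others (lemma \<open>elimination_order_of_domination\<close>). Deleting such vertices one at a time gives
  the order that a threshold graph requires.

  A convex function on a polytope attains its maximum at a vertex, hence the second claim. There
  is a vertex to speak of because there are enough edges for a graph with \<open>m\<close> of them to exist.
\<close>

section \<open>Edges\<close>

abbreviation edge :: "'n \<Rightarrow> 'n \<Rightarrow> real ^ 'n::finite" where
  "edge u v \<equiv> axis u 1 + axis v 1"

definition indicator_vector :: "'n set \<Rightarrow> real ^ 'n::finite" where
  "indicator_vector B = (\<chi> i. if i \<in> B then 1 else 0)"

lemma edge_vectors_eq_indicator_vectors:
  "(edge_vectors :: (real ^ 'n::finite) set) = indicator_vector ` {B. card B = 2}"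
proof (intro subset_antisym subsetI)
  fix x :: "real ^ 'n" assume x: "x \<in> edge_vectors"
  let ?B = "{i. x $ i = 1}"
  have x01: "x $ i = 0 \<or> x $ i = 1" for i
    using x by (auto simp: edge_vectors_def)
  have "\<bar>x $ i\<bar> = (if i \<in> ?B then 1 else 0)" for i
    using x01[of i] by auto
  then have "(\<Sum>i\<in>UNIV. \<bar>x $ i\<bar>) = real (card ?B)"
    by (simp add: sum.If_cases)
  then have "card ?B = 2"
    using x by (simp add: edge_vectors_def)
  moreover have "x = indicator_vector ?B"
    using x01 by (auto simp: indicator_vector_def vec_eq_iff)
  ultimately show "x \<in> indicator_vector ` {B. card B = 2}" by blast
next
  fix x :: "real ^ 'n" assume "x \<in> indicator_vector ` {B. card B = 2}"
  then obtain B where B: "card B = 2" "x = indicator_vector B" by blast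
  have "(\<Sum>i\<in>UNIV. \<bar>x $ i\<bar>) = (\<Sum>i\<in>UNIV. if i \<in> B then 1 else 0)"
    by (intro sum.cong) (auto simp: B(2) indicator_vector_def)
  also have "\<dots> = 2"
    using B(1) by (simp add: sum.If_cases)
  finally show "x \<in> edge_vectors"
    by (auto simp: edge_vectors_def B(2) indicator_vector_def)
qed

lemma inj_indicator_vector: "inj (indicator_vector :: 'n set \<Rightarrow> real ^ 'n::finite)"
proof (rule injI)
  fix A B :: "'n set" assume "(indicator_vector A :: real ^ 'n) = indicator_vector B"
  then have "(if i \<in> A then 1 else 0 :: real) = (if i \<in> B then 1 else 0)" for i
    by (simp add: indicator_vector_def vec_eq_iff)
  then have "i \<in> A \<longleftrightarrow> i \<in> B" for i
    by (smt (verit))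
  then show "A = B" by blast
qed

lemma card_edge_vectors: "card (edge_vectors :: (real ^ 'n::finite) set) = CARD('n) choose 2"
proof -
  have "card (edge_vectors :: (real ^ 'n) set) = card {B :: 'n set. card B = 2}"
    unfolding edge_vectors_eq_indicator_vectors
    by (intro card_image inj_on_subset[OF inj_indicator_vector]) auto
  then show ?thesis
    using n_subsets[of "UNIV :: 'n set" 2] by simp
qed

lemma finite_edge_vectors: "finite (edge_vectors :: (real ^ 'n::finite) set)"
  unfolding edge_vectors_eq_indicator_vectors by simp

lemma indicator_vector_doubleton:
  "u \<noteq> v \<Longrightarrow> (indicator_vector {u, v} :: real ^ 'n::finite) = edge u v"
  by (auto simp: indicator_vector_def vec_eq_iff axis_def)

lemma edge_vectors_iff_edge:
  "x \<in> edge_vectors \<longleftrightarrow> (\<exists>u v. u \<noteq> v \<and> x = edge u v)"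
proof
  assume "x \<in> edge_vectors"
  then obtain u v where "u \<noteq> v" "x = indicator_vector {u, v}"
    unfolding edge_vectors_eq_indicator_vectors by (auto simp: card_2_iff)
  then show "\<exists>u v. u \<noteq> v \<and> x = edge u v"
    using indicator_vector_doubleton by blast
next
  assume "\<exists>u v. u \<noteq> v \<and> x = edge u v"
  then obtain u v where uv: "u \<noteq> v" "x = edge u v" by blast
  then have "x = indicator_vector {u, v}" "card {u, v} = 2"
    by (simp_all add: indicator_vector_doubleton)
  then show "x \<in> edge_vectors"
    unfolding edge_vectors_eq_indicator_vectors by blast
qed

lemma adjacent_sym: "adjacent G u v \<longleftrightarrow> adjacent G v u"
  by (simp add: adjacent_def add.commute)

lemma inner_edge: "c \<bullet> edge u v = c $ u + c $ v"
  by (simp add: inner_add_right inner_axis)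

section \<open>Degree sequences\<close>

lemma finite_graph: "G \<in> graphs_with_edges m \<Longrightarrow> finite G"
  unfolding graphs_with_edges_def by (auto intro: finite_subset finite_edge_vectors)

lemma finite_graphs_with_edges: "finite (graphs_with_edges m :: (real ^ 'n::finite) set set)"
  by (rule finite_subset[of _ "Pow edge_vectors"])
     (auto simp: graphs_with_edges_def finite_edge_vectors)

lemma inner_degree_seq: "c \<bullet> degree_seq G = (\<Sum>e\<in>G. c \<bullet> e)"
  by (simp add: degree_seq_def inner_sum_right)

lemma degree_seq_exchange:
  assumes "finite G" "x \<in> G" "y \<notin> G"
  shows "degree_seq (insert y (G - {x})) = degree_seq G - x + y"
  using assms by (simp add: degree_seq_def sum_diff1)

lemma exchange_in_graphs_with_edges:
  assumes "G \<in> graphs_with_edges m" "x \<in> G" "y \<notin> G" "y \<in> edge_vectors"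
  shows "insert y (G - {x}) \<in> graphs_with_edges m"
  using assms finite_graph[OF assms(1)] card_Suc_Diff1[of G x]
  by (auto simp: graphs_with_edges_def)

lemma degree_seq_in_grid:
  assumes "G \<in> graphs_with_edges m" shows "degree_seq G \<in> grid m"
proof -
  have "degree_seq G $ i \<in> of_nat ` {0..m}" for i
  proof -
    have "x $ i = (if x \<in> {x. x $ i = 1} then 1 else 0)" if "x \<in> G" for x
      using assms that by (auto simp: graphs_with_edges_def edge_vectors_def)
    then have "degree_seq G $ i = (\<Sum>x\<in>G. if x \<in> {x. x $ i = 1} then 1 else 0)"
      unfolding degree_seq_def sum_component by (intro sum.cong) auto
    also have "\<dots> = of_nat (card (G \<inter> {x. x $ i = 1}))"
      using finite_graph[OF assms] by (simp add: sum.If_cases)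
    finally have "degree_seq G $ i = of_nat (card (G \<inter> {x. x $ i = 1}))" .
    moreover have "card (G \<inter> {x. x $ i = 1}) \<le> m"
      using assms finite_graph[OF assms] card_mono[of G "G \<inter> {x. x $ i = 1}"]
      by (auto simp: graphs_with_edges_def)
    ultimately show ?thesis by auto
  qed
  then show ?thesis by (simp add: grid_def)
qed

lemma polytope_degree_seq_polytope:
  "polytope (degree_seq_polytope m :: (real ^ 'n::finite) set)"
  unfolding degree_seq_polytope_def
  by (intro polytope_convex_hull) (simp add: Setcompr_eq_image finite_graphs_with_edges)

lemma degree_seq_in_polytope:
  "G \<in> graphs_with_edges m \<Longrightarrow> degree_seq G \<in> degree_seq_polytope m"
  unfolding degree_seq_polytope_def by (rule hull_inc) blast

section \<open>Threshold graphs yield vertices\<close>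

text \<open>
  The weight of the \<open>i\<close>-th vertex has absolute value \<open>i\<close>, so the sign of the sum of two weights
  is that of the later vertex, which records whether that vertex is joined to its predecessors.
\<close>

lemma threshold_graph_weights:
  fixes G :: "(real ^ 'n::finite) set"
  assumes "threshold_graph G"
  obtains c :: "real ^ 'n" where
    "\<And>e. e \<in> G \<Longrightarrow> c \<bullet> e > 0" "\<And>e. e \<in> edge_vectors - G \<Longrightarrow> c \<bullet> e < 0"
proof -
  let ?I = "{1..CARD('n)}"
  from assms obtain \<pi> :: "nat \<Rightarrow> 'n" where G: "G \<subseteq> edge_vectors"
    and \<pi>: "bij_betw \<pi> ?I UNIV"
    and hom: "\<And>i. i \<in> ?I \<Longrightarrow> (\<forall>j\<in>{1..<i}. adjacent G (\<pi> i) (\<pi> j)) \<or>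
          (\<forall>j\<in>{1..<i}. \<not> adjacent G (\<pi> i) (\<pi> j))"
    unfolding threshold_graph_def by blast
  define s :: "nat \<Rightarrow> real" where
    "s i = (if \<forall>j\<in>{1..<i}. adjacent G (\<pi> i) (\<pi> j) then real i else - real i)" for i
  define c :: "real ^ 'n" where "c = (\<chi> v. s (inv_into ?I \<pi> v))"
  have c: "c $ \<pi> i = s i" if "i \<in> ?I" for i
    using that \<pi> by (simp add: c_def bij_betw_def inv_into_f_f)
  have later: "if edge (\<pi> i) (\<pi> j) \<in> G then s i + s j > 0 else s i + s j < 0"
    if "i \<in> ?I" "j \<in> ?I" "j < i" for i j
  proof -
    have "adjacent G (\<pi> i) (\<pi> j) \<longleftrightarrow> (\<forall>j\<in>{1..<i}. adjacent G (\<pi> i) (\<pi> j))"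
      using hom[OF that(1)] that by fastforce
    moreover have "\<bar>s j\<bar> < real i"
      using that(3) by (simp add: s_def)
    ultimately show ?thesis
      by (auto simp: s_def[of i] adjacent_def)
  qed
  have sgn: "if e \<in> G then c \<bullet> e > 0 else c \<bullet> e < 0" if e: "e \<in> edge_vectors" for e
  proof -
    obtain u v where uv: "u \<noteq> v" "e = edge u v"
      using e edge_vectors_iff_edge by blast
    have "u \<in> \<pi> ` ?I" "v \<in> \<pi> ` ?I"
      using \<pi> by (simp_all add: bij_betw_def)
    then obtain i j where ij: "i \<in> ?I" "j \<in> ?I" "u = \<pi> i" "v = \<pi> j"
      by blast
    have "c \<bullet> e = s i + s j"
      by (simp only: uv(2) inner_edge ij(3,4) c[OF ij(1)] c[OF ij(2)])
    moreover have "i < j \<or> j < i"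
      using uv(1) ij by (metis linorder_neqE_nat)
    ultimately show ?thesis
      using later[of i j] later[of j i] ij uv(2) by (auto simp: add.commute)
  qed
  show ?thesis
  proof (rule that[of c])
    show "c \<bullet> e > 0" if "e \<in> G" for e
      using sgn[of e] that G by auto
    show "c \<bullet> e < 0" if "e \<in> edge_vectors - G" for e
      using sgn[of e] that by auto
  qed
qed

text \<open>
  Passing from \<open>G\<close> to \<open>H\<close> discards the elements of \<open>G - H\<close>, which have positive weight, in favour
  of elements of negative weight; as \<open>H \<noteq> G\<close> has the same cardinality, something is discarded.
\<close>

lemma sum_less_sum_positive_part:
  fixes w :: "'a \<Rightarrow> real"
  assumes "finite E" "G \<subseteq> E" "H \<subseteq> E" "card H = card G" "H \<noteq> G"
    and pos: "\<And>e. e \<in> G \<Longrightarrow> w e > 0" and neg: "\<And>e. e \<in> E - G \<Longrightarrow> w e < 0"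
  shows "sum w H < sum w G"
proof -
  have fin: "finite G" "finite H" using assms(1-3) by (auto intro: finite_subset)
  have "G - H \<noteq> {}"
    using assms(4,5) fin card_subset_eq[of H G] by auto
  then have "0 < sum w (G - H)"
    using fin pos by (intro sum_pos) auto
  moreover have "sum w (H - G) \<le> 0"
    using assms(3) neg by (intro sum_nonpos) (auto intro: less_imp_le)
  moreover have "sum w G = sum w (G - H) + sum w (G \<inter> H)"
    using sum.Int_Diff[OF fin(1), of w H] by simp
  moreover have "sum w H = sum w (H - G) + sum w (G \<inter> H)"
    using sum.Int_Diff[OF fin(2), of w G] by (simp add: Int_commute)
  ultimately show ?thesis by simp
qed

text \<open>
  All other degree sequences lie in an open halfspace whose boundary passes through that of \<open>G\<close>,
  so the latter is not in their convex hull.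
\<close>

lemma degree_seq_threshold_extreme:
  fixes G :: "(real ^ 'n::finite) set"
  assumes "threshold_graph G" "card G = m"
  shows "degree_seq G extreme_point_of degree_seq_polytope m"
proof -
  obtain c :: "real ^ 'n" where c: "\<And>e. e \<in> G \<Longrightarrow> c \<bullet> e > 0"
    "\<And>e. e \<in> edge_vectors - G \<Longrightarrow> c \<bullet> e < 0"
    using threshold_graph_weights[OF assms(1)] by blast
  have G: "G \<in> graphs_with_edges m"
    using assms by (simp add: graphs_with_edges_def threshold_graph_def)
  let ?D = "degree_seq ` graphs_with_edges m :: (real ^ 'n) set"
  let ?x = "degree_seq G"
  have "c \<bullet> degree_seq H < c \<bullet> ?x" if "H \<in> graphs_with_edges m" "H \<noteq> G" for H
    unfolding inner_degree_seq using that G c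
    by (intro sum_less_sum_positive_part[where E = edge_vectors])
       (auto simp: graphs_with_edges_def finite_edge_vectors)
  then have "?D - {?x} \<subseteq> {y. c \<bullet> y < c \<bullet> ?x}" by auto
  then have "convex hull (?D - {?x}) \<subseteq> {y. c \<bullet> y < c \<bullet> ?x}"
    by (rule hull_minimal) (rule convex_halfspace_lt)
  then have "?x extreme_point_of convex hull (insert ?x (?D - {?x}))"
    by (intro extreme_point_of_convex_hull_insert) (auto simp: finite_graphs_with_edges)
  moreover have "insert ?x (?D - {?x}) = {degree_seq H | H. H \<in> graphs_with_edges m}"
    using G by blast
  ultimately show ?thesis by (simp add: degree_seq_polytope_def)
qed

section \<open>Vertices come from threshold graphs\<close>

text \<open>
  Let \<open>w\<close> minimise \<open>c\<close> on \<open>S\<close>. If \<open>w\<close> has a neighbour \<open>x\<close> in \<open>S\<close>, then every other vertex of \<open>S\<close>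
  dominates \<open>w\<close> and so is joined to \<open>x\<close>; hence \<open>x\<close> is joined to all the others. If not, \<open>w\<close> is
  isolated in \<open>S\<close>. Either way some vertex can be placed last in the order.
\<close>

lemma elimination_order_of_domination:
  fixes R :: "'a \<Rightarrow> 'a \<Rightarrow> bool" and c :: "'a \<Rightarrow> real"
  assumes "finite S" and sym: "\<And>u v. R u v \<Longrightarrow> R v u"
    and dom: "\<And>u v x. c v \<le> c u \<Longrightarrow> R v x \<Longrightarrow> x \<noteq> u \<Longrightarrow> R u x"
  shows "\<exists>\<pi>. bij_betw \<pi> {1..card S} S \<and>
    (\<forall>i\<in>{1..card S}. (\<forall>j\<in>{1..<i}. R (\<pi> i) (\<pi> j)) \<or> (\<forall>j\<in>{1..<i}. \<not> R (\<pi> i) (\<pi> j)))"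
  using \<open>finite S\<close>
proof (induction "card S" arbitrary: S)
  case 0
  then show ?case by (simp add: bij_betw_def)
next
  case (Suc k)
  then have fin: "finite S" and ne: "S \<noteq> {}" by auto
  obtain w where w: "w \<in> S" "\<And>v. v \<in> S \<Longrightarrow> c w \<le> c v"
    using arg_min_if_finite(1)[OF fin ne, of c] arg_min_least[OF fin ne, of _ c] by blast
  have "\<exists>z\<in>S. (\<forall>v\<in>S - {z}. R z v) \<or> (\<forall>v\<in>S - {z}. \<not> R z v)"
  proof (cases "\<exists>x\<in>S. R w x")
    case True
    then obtain x where x: "x \<in> S" "R w x" by blast
    have "R x v" if "v \<in> S - {x}" for v
      using that w(2)[of v] sym[OF dom[of w v x]] x(2) by blast
    then show ?thesis using x(1) by blast
  next
    case False
    then show ?thesis using w(1) by blast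
  qed
  then obtain z where z: "z \<in> S" "(\<forall>v\<in>S - {z}. R z v) \<or> (\<forall>v\<in>S - {z}. \<not> R z v)"
    by blast
  have k: "k = card (S - {z})" using Suc.hyps(2) z(1) by simp
  from Suc.hyps(1)[OF k] fin obtain \<pi> where \<pi>: "bij_betw \<pi> {1..k} (S - {z})"
    and hom: "\<forall>i\<in>{1..k}. (\<forall>j\<in>{1..<i}. R (\<pi> i) (\<pi> j)) \<or> (\<forall>j\<in>{1..<i}. \<not> R (\<pi> i) (\<pi> j))"
    unfolding k[symmetric] by blast
  let ?\<rho> = "\<pi>(Suc k := z)"
  have "bij_betw ?\<rho> {1..k} (S - {z})"
    using \<pi> by (subst bij_betw_cong[of _ _ \<pi>]) auto
  moreover have "bij_betw ?\<rho> {Suc k} {z}"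
    by (simp add: bij_betw_def)
  ultimately have "bij_betw ?\<rho> ({1..k} \<union> {Suc k}) (S - {z} \<union> {z})"
    by (rule bij_betw_combine) blast
  moreover have "{1..k} \<union> {Suc k} = {1..Suc k}" "S - {z} \<union> {z} = S"
    using z(1) by auto
  ultimately have bij: "bij_betw ?\<rho> {1..Suc k} S" by simp
  have "(\<forall>j\<in>{1..<i}. R (?\<rho> i) (?\<rho> j)) \<or> (\<forall>j\<in>{1..<i}. \<not> R (?\<rho> i) (?\<rho> j))"
    if i: "i \<in> {1..Suc k}" for i
  proof (cases "i = Suc k")
    case True
    have "\<pi> j \<in> S - {z}" if "j \<in> {1..<Suc k}" for j
      using \<pi> that by (auto simp: bij_betw_def)
    then show ?thesis using z(2) True by auto
  next
    case False
    then have "i \<in> {1..k}" using i by auto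
    then show ?thesis using bspec[OF hom, of i] by auto
  qed
  with bij show ?case unfolding Suc.hyps(2)[symmetric] by blast
qed

text \<open>
  The functional exposing the vertex orders the vertices of the graph by domination: an
  edge exchange that violated it would yield a second maximiser.
\<close>

lemma extreme_degree_seq_threshold:
  fixes G :: "(real ^ 'n::finite) set"
  assumes ext: "degree_seq G extreme_point_of degree_seq_polytope m"
    and G: "G \<in> graphs_with_edges m"
  shows "threshold_graph G"
proof -
  let ?P = "degree_seq_polytope m :: (real ^ 'n) set"
  have sub: "G \<subseteq> edge_vectors" using G by (simp add: graphs_with_edges_def)
  have "{degree_seq G} exposed_face_of ?P"
    using ext by (simp add: exposed_face_of_polyhedron polytope_imp_polyhedron
        polytope_degree_seq_polytope face_of_singleton)
  then obtain c b where cb: "?P \<subseteq> {x. c \<bullet> x \<le> b}" "{degree_seq G} = ?P \<inter> {x. c \<bullet> x = b}"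
    unfolding exposed_face_of_def by blast
  have max: "degree_seq H = degree_seq G" if "H \<in> graphs_with_edges m"
    "c \<bullet> degree_seq G \<le> c \<bullet> degree_seq H" for H
  proof -
    have "degree_seq H \<in> ?P" using that(1) by (rule degree_seq_in_polytope)
    moreover have "c \<bullet> degree_seq G = b" using cb(2) by auto
    ultimately show ?thesis using cb that(2) by fastforce
  qed
  have dom: "adjacent G u x" if "c $ v \<le> c $ u" "adjacent G v x" "x \<noteq> u" for u v x
  proof (rule ccontr)
    assume na: "\<not> adjacent G u x"
    let ?H = "insert (edge u x) (G - {edge v x})"
    have xy: "edge v x \<in> G" "edge u x \<notin> G"
      using that(2) na by (auto simp: adjacent_def)
    have "edge u x \<in> edge_vectors"
      using that(3) edge_vectors_iff_edge by metis
    then have H: "?H \<in> graphs_with_edges m"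
      by (intro exchange_in_graphs_with_edges G xy)
    have d: "degree_seq ?H = degree_seq G - edge v x + edge u x"
      by (intro degree_seq_exchange finite_graph[OF G] xy)
    then have "c \<bullet> degree_seq G \<le> c \<bullet> degree_seq ?H"
      using that(1) by (simp add: inner_diff_right inner_add_right inner_axis)
    then have "edge v x = edge u x" using max[OF H] d by simp
    then show False using xy by simp
  qed
  obtain \<pi> :: "nat \<Rightarrow> 'n" where "bij_betw \<pi> {1..CARD('n)} UNIV \<and>
    (\<forall>i\<in>{1..CARD('n)}. (\<forall>j\<in>{1..<i}. adjacent G (\<pi> i) (\<pi> j)) \<or>
       (\<forall>j\<in>{1..<i}. \<not> adjacent G (\<pi> i) (\<pi> j)))"
    using elimination_order_of_domination[of "UNIV :: 'n set" "adjacent G" "\<lambda>v. c $ v"]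
      adjacent_sym[of G] dom by auto
  then show ?thesis unfolding threshold_graph_def using sub by blast
qed

section \<open>Vertices and convex maximisation\<close>

theorem theorem6p2:
  fixes m :: nat
  assumes "m \<le> CARD('n::finite) choose 2"
  shows "{x. x extreme_point_of (degree_seq_polytope m :: (real ^ 'n) set)} =
           {degree_seq G | G. threshold_graph G \<and> card G = m}
       \<and> (\<forall>f :: real ^ 'n \<Rightarrow> real. convex_on_grid m f \<longrightarrow>
            (\<exists>G. threshold_graph G \<and> card G = m \<and>
              (\<forall>H\<in>graphs_with_edges m. f (degree_seq H) \<le> f (degree_seq G))))"
proof (intro conjI allI impI)
  let ?P = "degree_seq_polytope m :: (real ^ 'n) set"
  let ?V = "{x. x extreme_point_of ?P}"
  show V: "?V = {degree_seq G | G. threshold_graph G \<and> card G = m}"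
  proof (intro subset_antisym subsetI)
    fix x assume "x \<in> ?V"
    then have x: "x extreme_point_of ?P" by simp
    then obtain G where G: "G \<in> graphs_with_edges m" "x = degree_seq G"
      unfolding degree_seq_polytope_def
      using extreme_point_of_convex_hull by blast
    then show "x \<in> {degree_seq G | G. threshold_graph G \<and> card G = m}"
      using extreme_degree_seq_threshold x by (auto simp: graphs_with_edges_def)
  qed (auto intro: degree_seq_threshold_extreme)
  fix f :: "real ^ 'n \<Rightarrow> real" assume "convex_on_grid m f"
  then obtain g where g: "convex_on UNIV g" "\<And>x. x \<in> grid m \<Longrightarrow> f x = g x"
    unfolding convex_on_grid_def by blast
  have KM: "?P = convex hull ?V"
    by (intro Krein_Milman_Minkowski polytope_imp_compact polytope_imp_convex
        polytope_degree_seq_polytope)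
  have "finite ?V"
    by (intro finite_polyhedron_extreme_points polytope_imp_polyhedron polytope_degree_seq_polytope)
  moreover have "?V \<noteq> {}"
  proof -
    obtain G :: "(real ^ 'n) set" where "G \<subseteq> edge_vectors" "card G = m"
      using assms obtain_subset_with_card_n unfolding card_edge_vectors[symmetric] by metis
    then have "degree_seq G \<in> ?P"
      by (intro degree_seq_in_polytope) (simp add: graphs_with_edges_def)
    then show ?thesis using KM by (metis convex_hull_empty empty_iff)
  qed
  ultimately obtain x where x: "x \<in> ?V" "\<And>y. y \<in> ?V \<Longrightarrow> g y \<le> g x"
    using arg_min_if_finite(1)[of ?V "\<lambda>y. - g y"] arg_min_least[of ?V _ "\<lambda>y. - g y"]
    by fastforce
  then obtain G where G: "threshold_graph G" "card G = m" "x = degree_seq G"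
    using V by blast
  have "f (degree_seq H) \<le> f (degree_seq G)" if H: "H \<in> graphs_with_edges m" for H
  proof -
    have "\<forall>y\<in>convex hull ?V. g y \<le> g x"
      using x(2) by (intro convex_on_convex_hull_bound convex_on_subset[OF g(1)]) auto
    then have "g (degree_seq H) \<le> g (degree_seq G)"
      using degree_seq_in_polytope[OF H] KM G(3) by blast
    moreover have "G \<in> graphs_with_edges m"
      using G by (simp add: graphs_with_edges_def threshold_graph_def)
    ultimately show ?thesis
      using H by (simp add: g(2) degree_seq_in_grid)
  qed
  then show "\<exists>G. threshold_graph G \<and> card G = m \<and>
      (\<forall>H\<in>graphs_with_edges m. f (degree_seq H) \<le> f (degree_seq G))"
    using G by blast
qed

end
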